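(* Fix $d\in\mathbb{N}$ and let $(P_t)_{t\ge0}$ be a Markov semigroup acting on suitable functions $\boldsymbol{f}:\Omega\to\mathbb{H}_d$ by $(P_t\boldsymbol{f})(z)=\mathbb{E}[\boldsymbol{f}(Z_t)\mid Z_0=z]$, where $(Z_t)_{t\ge0}$ is a time-homogeneous Markov process on a Polish space $\Omega$ with stationary probability measure $\mu$. Let $c>0$. The following are equivalent: (1) (Bakry--\'Emery criterion) $\Gamma(\boldsymbol{f})\preccurlyeq c\cdot\Gamma_2(\boldsymbol{f})$ for all suitable $\boldsymbol{f}:\Omega\to\mathbb{H}_d$. (2) (Local ergodicity) $\Gamma(P_t\boldsymbol{f})\preccurlyeq e^{-2t/c}\cdot P_t\Gamma(\boldsymbol{f})$ for all $t\ge0$ and all suitable $\boldsymbol{f}:\Omega\to\mathbb{H}_d$. (3) (Local Poincar\'e inequality) $P_t(\boldsymbol{f}^2)-(P_t\boldsymbol{f})^2\preccurlyeq c\,(1-e^{-2t/c})\cdot P_t\Gamma(\boldsymbol{f})$ for all $t\ge0$ and all suitable $\boldsymbol{f}:\Omega\to\mathbb{H}_d$. (The inequalities are understood pointwise $\mu$-almost everywhere.)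
   Context: $\mathbb{M}_d$ is the algebra of $d\times d$ complex matrices, $\mathbb{H}_d$ its real subspace of Hermitian matrices; $\preccurlyeq$ is the positive-semidefinite order. The infinitesimal generator is $\mathcal{L}\boldsymbol{f}=\lim_{t\downarrow0}(P_t\boldsymbol{f}-\boldsymbol{f})/t$ (entrywise, also for $\mathbb{M}_d$-valued functions). The matrix carr\'e du champ and iterated carr\'e du champ operators are $$\Gamma(\boldsymbol{f},\boldsymbol{g})=\tfrac12[\mathcal{L}(\boldsymbol{f}\boldsymbol{g})-\boldsymbol{f}\mathcal{L}(\boldsymbol{g})-\mathcal{L}(\boldsymbol{f})\boldsymbol{g}],\qquad \Gamma_2(\boldsymbol{f},\boldsymbol{g})=\tfrac12[\mathcal{L}\Gamma(\boldsymbol{f},\boldsymbol{g})-\Gamma(\boldsymbol{f},\mathcal{L}(\boldsymbol{g}))-\Gamma(\mathcal{L}(\boldsymbol{f}),\boldsymbol{g})],$$ with $\Gamma(\boldsymbol{f})=\Gamma(\boldsymbol{f},\boldsymbol{f})$ and $\Gamma_2(\boldsymbol{f})=\Gamma_2(\boldsymbol{f},\boldsymbol{f})$. Suitable functions: a fixed class of functions $\Omega\to\mathbb{H}_d$ (an algebra of nice functions, e.g. smooth compactly supported ones in concrete cases) on which $\mathcal{L},\Gamma,\Gamma_2$ are defined, which is compatible with the operations used ($P_t$, $\mathcal{L}$, sums, products, constants), and on which all limits, time derivatives and expectations involved exist and may be interchanged; in particular $\frac{d}{dt}P_t=\mathcal{L}P_t=P_t\mathcal{L}$. *)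

theory Defs
  imports "HOL-Probability.Probability"
begin

section \<open>Hermitian matrices and the positive-semidefinite order\<close>

definition cadjoint :: "complex^'n^'n \<Rightarrow> complex^'n^'n" where
  "cadjoint A = (\<chi> i j. cnj (A $ j $ i))"

definition hermitian :: "complex^'n^'n \<Rightarrow> bool" where
  "hermitian A \<longleftrightarrow> cadjoint A = A"

definition psd :: "complex^'n^'n \<Rightarrow> bool" where
  "psd A \<longleftrightarrow> hermitian A \<and> (\<forall>v. 0 \<le> Re (\<Sum>i\<in>UNIV. cnj (v $ i) * (A *v v) $ i))"

definition psd_le :: "complex^'n^'n \<Rightarrow> complex^'n^'n \<Rightarrow> bool"  (infix \<open>\<preceq>\<close> 50) where
  "A \<preceq> B \<longleftrightarrow> psd (B - A)"


section \<open>Time-homogeneous Markov processes\<close>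

text \<open>
  A process is given as a Markov family: one sample space \<open>W\<close>, paths \<open>t \<mapsto> Z t w\<close> for \<open>t \<ge> 0\<close>, and
  for every starting point \<open>z\<close> a law \<open>\<P> z\<close> on \<open>W\<close>, under which the process starts at \<open>z\<close>.  Thus
  \<open>\<P> z\<close> is the conditional law of the process given \<open>Z\<^sub>0 = z\<close>.
\<close>

definition natural_filtration :: "'w measure \<Rightarrow> (real \<Rightarrow> 'w \<Rightarrow> 'a::topological_space) \<Rightarrow> real \<Rightarrow> 'w measure" where
  "natural_filtration W Z s =
     sigma (space W) {Z r -` B \<inter> space W | r B. 0 \<le> r \<and> r \<le> s \<and> B \<in> sets borel}"

definition transition_kernel ::
    "('a \<Rightarrow> 'w measure) \<Rightarrow> (real \<Rightarrow> 'w \<Rightarrow> 'a::topological_space) \<Rightarrow> real \<Rightarrow> 'a \<Rightarrow> 'a measure" where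
  "transition_kernel \<P> Z t z = distr (\<P> z) borel (Z t)"

locale markov_process =
  fixes W :: "'w measure"
    and \<P> :: "'a::polish_space \<Rightarrow> 'w measure"
    and Z :: "real \<Rightarrow> 'w \<Rightarrow> 'a"
  assumes prob_space_law: "prob_space (\<P> z)"
    and sets_law: "sets (\<P> z) = sets W"
    and measurable_process: "0 \<le> t \<Longrightarrow> Z t \<in> measurable W borel"
    and measurable_kernel: "0 \<le> t \<Longrightarrow> transition_kernel \<P> Z t \<in> measurable borel (prob_algebra borel)"
    and start: "AE w in \<P> z. Z 0 w = z"
    and markov_property:
      "\<lbrakk>0 \<le> s; 0 \<le> t; B \<in> sets borel\<rbrakk> \<Longrightarrow>
        AE w in \<P> z.
          real_cond_exp (\<P> z) (natural_filtration W Z s) (indicator {w' \<in> space W. Z (s + t) w' \<in> B}) w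
          = measure (transition_kernel \<P> Z t (Z s w)) B"

definition stationary :: "('a::polish_space \<Rightarrow> 'w measure) \<Rightarrow> (real \<Rightarrow> 'w \<Rightarrow> 'a) \<Rightarrow> 'a measure \<Rightarrow> bool" where
  "stationary \<P> Z \<mu> \<longleftrightarrow>
     sets \<mu> = sets borel \<and> prob_space \<mu> \<and> (\<forall>t\<ge>0. \<mu> \<bind> transition_kernel \<P> Z t = \<mu>)"

definition markov_semigroup ::
    "('a \<Rightarrow> 'w measure) \<Rightarrow> (real \<Rightarrow> 'w \<Rightarrow> 'a) \<Rightarrow> real \<Rightarrow> ('a \<Rightarrow> complex^'n^'n) \<Rightarrow> 'a \<Rightarrow> complex^'n^'n" where
  "markov_semigroup \<P> Z t f z = (\<integral>w. f (Z t w) \<partial>\<P> z)"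


section \<open>Generator and carr\'e du champ operators of a semigroup\<close>

definition generator ::
    "(real \<Rightarrow> ('a \<Rightarrow> complex^'n^'n) \<Rightarrow> 'a \<Rightarrow> complex^'n^'n) \<Rightarrow> ('a \<Rightarrow> complex^'n^'n) \<Rightarrow> 'a \<Rightarrow> complex^'n^'n" where
  "generator P f z = Lim (at_right 0) (\<lambda>t. (1 / t) *\<^sub>R (P t f z - f z))"

definition carre_du_champ ::
    "(real \<Rightarrow> ('a \<Rightarrow> complex^'n^'n) \<Rightarrow> 'a \<Rightarrow> complex^'n^'n) \<Rightarrow>
     ('a \<Rightarrow> complex^'n^'n) \<Rightarrow> ('a \<Rightarrow> complex^'n^'n) \<Rightarrow> 'a \<Rightarrow> complex^'n^'n" where
  "carre_du_champ P f g z = (1/2) *\<^sub>R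
     (generator P (\<lambda>x. f x ** g x) z - f z ** generator P g z - generator P f z ** g z)"

definition carre_du_champ2 ::
    "(real \<Rightarrow> ('a \<Rightarrow> complex^'n^'n) \<Rightarrow> 'a \<Rightarrow> complex^'n^'n) \<Rightarrow>
     ('a \<Rightarrow> complex^'n^'n) \<Rightarrow> ('a \<Rightarrow> complex^'n^'n) \<Rightarrow> 'a \<Rightarrow> complex^'n^'n" where
  "carre_du_champ2 P f g z = (1/2) *\<^sub>R
     (generator P (carre_du_champ P f g) z
      - carre_du_champ P f (generator P g) z - carre_du_champ P (generator P f) g z)"


section \<open>Suitable functions\<close>

text \<open>
  The product of two Hermitian matrices need not be Hermitian, so the algebra \<open>\<A>\<close> of nice functions
  consists of functions with arbitrary complex matrix values and is closed under pointwise adjoints;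
  the suitable functions are its Hermitian-valued members.

  The last three assumptions spell out the permitted interchanges for the curves
  \<open>h\<^sub>s = (P\<^sub>s f) (P\<^sub>s g)\<close>, whose time derivative is, by the product rule and \<open>d/ds P\<^sub>s = P\<^sub>s L\<close>,
  \<open>h'\<^sub>s = (P\<^sub>s (L f)) (P\<^sub>s g) + (P\<^sub>s f) (P\<^sub>s (L g))\<close>: differentiation in \<open>s\<close> may be interchanged
  with \<open>P\<^sub>u\<close> and with \<open>P\<^sub>u L\<close>, and \<open>P\<^sub>u L\<^sup>n h\<^sub>s\<close> is continuous in \<open>(u, s)\<close> for \<open>n \<le> 2\<close>, as many
  applications of \<open>L\<close> as occur in the second-order operator \<open>\<Gamma>\<^sub>2\<close>.
\<close>

locale suitable_algebra = markov_process W \<P> Z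
  for W :: "'w measure" and \<P> :: "'a::polish_space \<Rightarrow> 'w measure" and Z :: "real \<Rightarrow> 'w \<Rightarrow> 'a" +
  fixes \<A> :: "('a \<Rightarrow> complex^'n^'n) set"
  assumes suitable_measurable: "f \<in> \<A> \<Longrightarrow> f \<in> borel_measurable borel"
    and suitable_integrable: "\<lbrakk>f \<in> \<A>; 0 \<le> t\<rbrakk> \<Longrightarrow> integrable (\<P> z) (\<lambda>w. f (Z t w))"
    and const_closed: "(\<lambda>z. A) \<in> \<A>"
    and add_closed: "\<lbrakk>f \<in> \<A>; g \<in> \<A>\<rbrakk> \<Longrightarrow> (\<lambda>z. f z + g z) \<in> \<A>"
    and mult_closed: "\<lbrakk>f \<in> \<A>; g \<in> \<A>\<rbrakk> \<Longrightarrow> (\<lambda>z. f z ** g z) \<in> \<A>"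
    and adjoint_closed: "f \<in> \<A> \<Longrightarrow> (\<lambda>z. cadjoint (f z)) \<in> \<A>"
    and semigroup_closed: "\<lbrakk>f \<in> \<A>; 0 \<le> t\<rbrakk> \<Longrightarrow> markov_semigroup \<P> Z t f \<in> \<A>"
    and generator_closed: "f \<in> \<A> \<Longrightarrow> generator (markov_semigroup \<P> Z) f \<in> \<A>"
    and generator_limit: "f \<in> \<A> \<Longrightarrow>
      ((\<lambda>t. (1 / t) *\<^sub>R (markov_semigroup \<P> Z t f z - f z))
         \<longlongrightarrow> generator (markov_semigroup \<P> Z) f z) (at_right 0)"
    and semigroup_derivative: "\<lbrakk>f \<in> \<A>; 0 \<le> t\<rbrakk> \<Longrightarrow>
      ((\<lambda>s. markov_semigroup \<P> Z s f z) has_vector_derivative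
         markov_semigroup \<P> Z t (generator (markov_semigroup \<P> Z) f) z) (at t within {0..})"
    and generator_commutes: "\<lbrakk>f \<in> \<A>; 0 \<le> t\<rbrakk> \<Longrightarrow>
      generator (markov_semigroup \<P> Z) (markov_semigroup \<P> Z t f)
      = markov_semigroup \<P> Z t (generator (markov_semigroup \<P> Z) f)"
    and interchange_semigroup: "\<lbrakk>f \<in> \<A>; g \<in> \<A>; 0 \<le> u; 0 \<le> s\<rbrakk> \<Longrightarrow>
      ((\<lambda>r. markov_semigroup \<P> Z u (\<lambda>x. markov_semigroup \<P> Z r f x ** markov_semigroup \<P> Z r g x) z)
       has_vector_derivative
         markov_semigroup \<P> Z u
           (\<lambda>x. markov_semigroup \<P> Z s (generator (markov_semigroup \<P> Z) f) x ** markov_semigroup \<P> Z s g x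
              + markov_semigroup \<P> Z s f x ** markov_semigroup \<P> Z s (generator (markov_semigroup \<P> Z) g) x) z)
       (at s within {0..})"
    and interchange_generator: "\<lbrakk>f \<in> \<A>; g \<in> \<A>; 0 \<le> u; 0 \<le> s\<rbrakk> \<Longrightarrow>
      ((\<lambda>r. markov_semigroup \<P> Z u (generator (markov_semigroup \<P> Z)
              (\<lambda>x. markov_semigroup \<P> Z r f x ** markov_semigroup \<P> Z r g x)) z)
       has_vector_derivative
         markov_semigroup \<P> Z u (generator (markov_semigroup \<P> Z)
           (\<lambda>x. markov_semigroup \<P> Z s (generator (markov_semigroup \<P> Z) f) x ** markov_semigroup \<P> Z s g x
              + markov_semigroup \<P> Z s f x ** markov_semigroup \<P> Z s (generator (markov_semigroup \<P> Z) g) x)) z)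
       (at s within {0..})"
    and product_continuous: "\<lbrakk>f \<in> \<A>; g \<in> \<A>; n \<le> (2::nat)\<rbrakk> \<Longrightarrow>
      continuous_on ({0..} \<times> {0..})
        (\<lambda>(u, s). markov_semigroup \<P> Z u ((generator (markov_semigroup \<P> Z) ^^ n)
           (\<lambda>x. markov_semigroup \<P> Z s f x ** markov_semigroup \<P> Z s g x)) z)"

definition suitable :: "('a \<Rightarrow> complex^'n^'n) set \<Rightarrow> ('a \<Rightarrow> complex^'n^'n) set" where
  "suitable \<A> = {f \<in> \<A>. \<forall>z. hermitian (f z)}"

end

theory Submission
  imports Defs
begin

text \<open>
  Write \<open>T\<^sub>t\<close> for the semigroup and \<open>L\<close> for its generator.  Both equivalences come from moving
  time from the outer to the inner semigroup.  For \<open>0 \<le> s \<le> t\<close>, \<open>dT\<^sub>s/ds = T\<^sub>s L\<close> and the product rule give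

  \<^item> \<open>d/ds T\<^sub>s((T\<^bsub>t-s\<^esub> f)\<^sup>2) = 2 T\<^sub>s \<Gamma>(T\<^bsub>t-s\<^esub> f)\<close>, and
  \<^item> \<open>d/ds T\<^sub>s \<Gamma>(T\<^bsub>t-s\<^esub> f) = 2 T\<^sub>s \<Gamma>\<^sub>2(T\<^bsub>t-s\<^esub> f)\<close>.

  If \<open>\<Gamma> \<preceq> c \<Gamma>\<^sub>2\<close>, the second curve \<open>G\<close> satisfies \<open>G' \<succeq> (2/c) G\<close>, so \<open>exp (-2 s/c) G(s)\<close> increases;
  comparing its values at \<open>s = 0\<close> and \<open>s = t\<close> is local ergodicity.  Local ergodicity bounds the
  derivative of the first curve by \<open>2 exp (-2 (t-s)/c) T\<^sub>t \<Gamma>(f)\<close>, by the semigroup law, and integrating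
  over \<open>[0, t]\<close> is the local Poincare inequality.  Finally, the right-hand side of the
  Poincare inequality minus its left-hand side vanishes to first order at \<open>t = 0\<close> and has second derivative
  \<open>4 \<Gamma>\<^sub>2(f) - (4/c) \<Gamma>(f)\<close> there, which must therefore be positive semidefinite.

  Matrix inequalities become real ones by testing with the quadratic forms \<open>quad v\<close>.  Two points
  remain.  An inequality that holds \<open>\<mu>\<close>-almost everywhere survives an application of \<open>T\<^sub>s\<close> because
  \<open>\<mu>\<close> is stationary (\<open>AE_psd_semigroup\<close>); and the exceptional null set may depend on \<open>s\<close>, but since all
  curves are continuous in \<open>s\<close>, one null set serves for all \<open>s\<close> (\<open>AE_all_continuous\<close>).
\<close>

section \<open>The positive-semidefinite cone\<close>

definition quad :: "complex^'n \<Rightarrow> complex^'n^'n \<Rightarrow> real" where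
  "quad v A = Re (\<Sum>i\<in>UNIV. cnj (v $ i) * (A *v v) $ i)"

lemma psd_iff_quad: "psd A \<longleftrightarrow> hermitian A \<and> (\<forall>v. 0 \<le> quad v A)"
  by (simp add: psd_def quad_def)

lemma bounded_linear_quad: "bounded_linear (quad v)"
  unfolding linear_conv_bounded_linear[symmetric]
  by (rule linearI)
    (simp_all add: quad_def matrix_vector_mult_def sum.distrib sum_distrib_left
      scaleR_sum_right algebra_simps)

lemma bounded_linear_cadjoint: "bounded_linear cadjoint"
  unfolding linear_conv_bounded_linear[symmetric]
  by (rule linearI) (simp_all add: cadjoint_def vec_eq_iff)

lemma bounded_bilinear_matrix_mult:
  "bounded_bilinear ((**) :: complex^'n^'m \<Rightarrow> complex^'k^'n \<Rightarrow> complex^'k^'m)"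
  unfolding bilinear_conv_bounded_bilinear[symmetric] bilinear_def
  by (auto intro!: linearI
      simp: matrix_matrix_mult_def vec_eq_iff sum.distrib scaleR_sum_right algebra_simps)

lemmas quad_simps =
  linear_0[OF bounded_linear_quad[THEN bounded_linear.linear]]
  linear_add[OF bounded_linear_quad[THEN bounded_linear.linear]]
  linear_diff[OF bounded_linear_quad[THEN bounded_linear.linear]]
  linear_cmul[OF bounded_linear_quad[THEN bounded_linear.linear]]

lemmas cadjoint_simps =
  linear_add[OF bounded_linear_cadjoint[THEN bounded_linear.linear]]
  linear_diff[OF bounded_linear_cadjoint[THEN bounded_linear.linear]]
  linear_cmul[OF bounded_linear_cadjoint[THEN bounded_linear.linear]]

lemma cadjoint_mult: "cadjoint (A ** B) = cadjoint B ** cadjoint A"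
  by (simp add: cadjoint_def matrix_matrix_mult_def vec_eq_iff mult.commute)

lemma psd_leI:
  assumes "hermitian A" "hermitian B" "\<And>v. quad v A \<le> quad v B"
  shows "A \<preceq> B"
  using assms by (simp add: psd_le_def psd_iff_quad hermitian_def cadjoint_simps quad_simps)

lemma closed_psd: "closed {A. psd A}"
proof -
  have "closed {A :: complex^'a^'a. cadjoint A = A}"
    by (intro closed_Collect_eq continuous_intros bounded_linear.continuous_on[OF bounded_linear_cadjoint])
  moreover have "closed {A. 0 \<le> quad v A}" for v :: "complex^'a"
    by (intro closed_Collect_le continuous_intros bounded_linear.continuous_on[OF bounded_linear_quad])
  ultimately show ?thesis
    unfolding psd_iff_quad hermitian_def
    by (intro closed_Collect_conj closed_Collect_all)
qed

section \<open>Calculus on half-lines\<close>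

text \<open>
  The chain rule for \<open>r \<mapsto> (r, t - r)\<close>.  Continuity of the second partial derivative makes \<open>F\<close>
  differentiable as a function on the quadrant.
\<close>
lemma has_vector_derivative_antidiagonal:
  fixes F :: "real \<Rightarrow> real \<Rightarrow> 'b::real_normed_vector"
  assumes F1: "\<And>u s. \<lbrakk>0 \<le> u; 0 \<le> s\<rbrakk> \<Longrightarrow>
      ((\<lambda>u. F u s) has_vector_derivative F1 u s) (at u within {0..})"
    and F2: "\<And>u s. \<lbrakk>0 \<le> u; 0 \<le> s\<rbrakk> \<Longrightarrow>
      ((\<lambda>s. F u s) has_vector_derivative F2 u s) (at s within {0..})"
    and cont: "continuous_on ({0..} \<times> {0..}) (\<lambda>(u, s). F2 u s)"
    and s: "0 \<le> s" "s \<le> t"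
  shows "((\<lambda>r. F r (t - r)) has_vector_derivative (F1 s (t - s) - F2 s (t - s))) (at s within {0..t})"
proof -
  have FD: "((\<lambda>(x, y). F x y) has_derivative
      (\<lambda>(tx, ty). tx *\<^sub>R F1 s (t - s) + blinfun_apply (blinfun_scaleR_left (F2 s (t - s))) ty))
      (at (s, t - s) within {0..} \<times> {0..})"
  proof (rule has_derivative_partialsI)
    show "((\<lambda>x. F x (t - s)) has_derivative (\<lambda>tx. tx *\<^sub>R F1 s (t - s))) (at s within {0..})"
      using F1[of s "t - s"] s by (simp add: has_vector_derivative_def)
    show "((\<lambda>y. F x y) has_derivative blinfun_apply (blinfun_scaleR_left (F2 x y))) (at y within {0..})"
      if "x \<in> {0..}" "y \<in> {0..}" for x y
      using F2[of x y] that by (simp add: has_vector_derivative_def)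
    have "continuous_on ({0..} \<times> {0..}) (\<lambda>z. blinfun_scaleR_left (case z of (u, s) \<Rightarrow> F2 u s))"
      by (rule bounded_linear.continuous_on[OF bounded_linear_blinfun_scaleR_left cont])
    then show "continuous (at (s, t - s) within {0..} \<times> {0..})
        (\<lambda>(x, y). blinfun_scaleR_left (F2 x y))"
      using s by (auto simp: continuous_on_eq_continuous_within case_prod_beta')
  qed (use s in auto)
  have "((\<lambda>r. (r, t - r)) has_derivative (\<lambda>h. (h, - h))) (at s within {0..t})"
    by (auto intro!: derivative_eq_intros)
  moreover have "(\<lambda>r. (r, t - r)) ` {0..t} \<subseteq> {0..} \<times> {0..}"
    by auto
  note has_derivative_in_compose[OF calculation has_derivative_subset[OF FD this]]
  then show ?thesis
    by (simp add: has_vector_derivative_def algebra_simps)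
qed

lemma nondecreasing_of_vector_derivative:
  fixes \<phi> :: "real \<Rightarrow> real"
  assumes "a \<le> b"
    and "\<And>s. \<lbrakk>a \<le> s; s \<le> b\<rbrakk> \<Longrightarrow> (\<phi> has_vector_derivative \<phi>' s) (at s within {a..b})"
    and "\<And>s. \<lbrakk>a \<le> s; s \<le> b\<rbrakk> \<Longrightarrow> 0 \<le> \<phi>' s"
  shows "\<phi> a \<le> \<phi> b"
proof -
  have "\<exists>x\<in>{a..b}. \<phi> b - \<phi> a = (b - a) *\<^sub>R \<phi>' x"
    using assms(1,2) unfolding has_vector_derivative_def by (rule mvt_very_simple)
  then obtain x where "x \<in> {a..b}" "\<phi> b - \<phi> a = (b - a) * \<phi>' x"
    by auto
  with assms(1,3) have "0 \<le> \<phi> b - \<phi> a"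
    by simp
  then show ?thesis by simp
qed

text \<open>
  If the second derivative at 0 were negative, \<open>\<phi>'\<close> would be negative just to the right of 0, and \<open>\<phi>\<close>
  would fall below its initial value 0.
\<close>
lemma second_derivative_nonneg:
  fixes \<phi> :: "real \<Rightarrow> real"
  assumes d1: "\<And>s. 0 \<le> s \<Longrightarrow> (\<phi> has_vector_derivative \<phi>' s) (at s within {0..})"
    and d2: "(\<phi>' has_vector_derivative D) (at 0 within {0..})"
    and zero: "\<phi> 0 = 0" "\<phi>' 0 = 0"
    and nonneg: "\<And>t. 0 \<le> t \<Longrightarrow> 0 \<le> \<phi> t"
  shows "0 \<le> D"
proof (rule ccontr)
  assume "\<not> 0 \<le> D"
  have "((\<lambda>h. \<phi>' h / h) \<longlongrightarrow> D) (at 0 within {0..})"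
    using d2 zero by (simp add: has_real_derivative_iff_has_vector_derivative[symmetric] has_field_derivative_iff)
  with \<open>\<not> 0 \<le> D\<close> have "eventually (\<lambda>h. \<phi>' h / h < 0) (at 0 within {0..})"
    by (auto simp: order_tendsto_iff)
  then obtain d where d: "d > 0" "\<And>h. \<lbrakk>0 < h; h < d\<rbrakk> \<Longrightarrow> \<phi>' h < 0"
    unfolding eventually_at by (auto simp: dist_real_def divide_less_0_iff)
  define b where "b = d / 2"
  have b: "0 < b" "b < d"
    using d by (auto simp: b_def)
  have "\<exists>x\<in>{0<..<b}. \<phi> b - \<phi> 0 = (b - 0) *\<^sub>R \<phi>' x"
  proof (rule mvt_simple)
    show "(\<phi> has_derivative (\<lambda>h. h *\<^sub>R \<phi>' x)) (at x within {0..b})" if "0 \<le> x" "x \<le> b" for x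
      using d1[OF that(1)] unfolding has_vector_derivative_def
      by (rule has_derivative_subset) auto
  qed (use b in auto)
  then obtain x where x: "0 < x" "x < b" "\<phi> b = b * \<phi>' x"
    using zero by auto
  with d b have "\<phi> b < 0"
    by (auto simp: mult_less_0_iff)
  with nonneg[of b] b show False by simp
qed

section \<open>Null sets along continuous curves\<close>

text \<open>
  The union of the null sets over a countable dense set of parameters is still a null set, and off it
  continuity extends membership in the closed set \<open>C\<close> to all parameters.
\<close>
lemma AE_all_continuous:
  fixes X :: "'i::euclidean_space \<Rightarrow> 'z \<Rightarrow> 'b::topological_space"
  assumes "closed C"
    and "\<And>z. continuous_on S (\<lambda>s. X s z)"
    and "\<And>s. s \<in> S \<Longrightarrow> AE z in M. X s z \<in> C"
  shows "AE z in M. \<forall>s\<in>S. X s z \<in> C"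
proof -
  obtain D where D: "countable D" "D \<subseteq> S" "S \<subseteq> closure D"
    by (rule separable)
  have "AE z in M. \<forall>s\<in>D. X s z \<in> C"
    using D assms(3) by (subst AE_ball_countable) auto
  then show ?thesis
  proof eventually_elim
    fix z assume D_in: "\<forall>s\<in>D. X s z \<in> C"
    have "closedin (top_of_set S) (S \<inter> (\<lambda>s. X s z) -` C)"
      using assms(1,2) by (intro continuous_closedin_preimage)
    then obtain U where "closed U" "S \<inter> (\<lambda>s. X s z) -` C = S \<inter> U"
      by (auto simp: closedin_closed)
    moreover from this D D_in have "closure D \<subseteq> U"
      by (intro closure_minimal) auto
    ultimately show "\<forall>s\<in>S. X s z \<in> C"
      using D by auto
  qed
qed

section \<open>Algebra of the semigroup and its generator\<close>

context suitable_algebra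
begin

abbreviation T :: "real \<Rightarrow> ('a \<Rightarrow> complex^'n^'n) \<Rightarrow> 'a \<Rightarrow> complex^'n^'n" where
  "T \<equiv> markov_semigroup \<P> Z"

abbreviation L :: "('a \<Rightarrow> complex^'n^'n) \<Rightarrow> 'a \<Rightarrow> complex^'n^'n" where
  "L \<equiv> generator T"

abbreviation \<Gamma> :: "('a \<Rightarrow> complex^'n^'n) \<Rightarrow> ('a \<Rightarrow> complex^'n^'n) \<Rightarrow> 'a \<Rightarrow> complex^'n^'n" where
  "\<Gamma> \<equiv> carre_du_champ T"

abbreviation \<Gamma>\<^sub>2 :: "('a \<Rightarrow> complex^'n^'n) \<Rightarrow> ('a \<Rightarrow> complex^'n^'n) \<Rightarrow> 'a \<Rightarrow> complex^'n^'n" where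
  "\<Gamma>\<^sub>2 \<equiv> carre_du_champ2 T"

lemma scaleR_closed:
  assumes "f \<in> \<A>"
  shows "(\<lambda>z. r *\<^sub>R f z) \<in> \<A>"
proof -
  have "(\<lambda>z. (r *\<^sub>R mat 1) ** f z) \<in> \<A>"
    using assms by (intro mult_closed const_closed)
  then show ?thesis
    by (simp add: scalar_matrix_assoc[symmetric])
qed

lemma diff_closed:
  assumes "f \<in> \<A>" "g \<in> \<A>"
  shows "(\<lambda>z. f z - g z) \<in> \<A>"
  using add_closed[OF assms(1) scaleR_closed[OF assms(2), of "-1"]] by simp

lemma carre_du_champ_closed: "\<lbrakk>f \<in> \<A>; g \<in> \<A>\<rbrakk> \<Longrightarrow> \<Gamma> f g \<in> \<A>"
  unfolding carre_du_champ_def[abs_def]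
  by (intro scaleR_closed diff_closed mult_closed generator_closed)

lemma carre_du_champ2_closed: "\<lbrakk>f \<in> \<A>; g \<in> \<A>\<rbrakk> \<Longrightarrow> \<Gamma>\<^sub>2 f g \<in> \<A>"
  unfolding carre_du_champ2_def[abs_def]
  by (intro scaleR_closed diff_closed carre_du_champ_closed generator_closed)

lemmas closed_intros =
  const_closed add_closed mult_closed adjoint_closed semigroup_closed generator_closed
  scaleR_closed diff_closed carre_du_champ_closed carre_du_champ2_closed

lemma semigroup_add:
  "\<lbrakk>f \<in> \<A>; g \<in> \<A>; 0 \<le> t\<rbrakk> \<Longrightarrow> T t (\<lambda>x. f x + g x) z = T t f z + T t g z"
  by (simp add: markov_semigroup_def suitable_integrable)

lemma semigroup_diff:
  "\<lbrakk>f \<in> \<A>; g \<in> \<A>; 0 \<le> t\<rbrakk> \<Longrightarrow> T t (\<lambda>x. f x - g x) z = T t f z - T t g z"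
  by (simp add: markov_semigroup_def suitable_integrable)

lemma semigroup_scaleR: "T t (\<lambda>x. r *\<^sub>R f x) z = r *\<^sub>R T t f z"
  by (simp add: markov_semigroup_def)

lemma semigroup_const: "T t (\<lambda>x. A) = (\<lambda>z. A)"
proof
  fix z
  interpret prob_space "\<P> z" by (rule prob_space_law)
  show "T t (\<lambda>x. A) z = A"
    by (simp add: markov_semigroup_def prob_space)
qed

lemma semigroup_adjoint:
  assumes "f \<in> \<A>" "0 \<le> t"
  shows "T t (\<lambda>x. cadjoint (f x)) z = cadjoint (T t f z)"
  unfolding markov_semigroup_def
  using assms by (intro integral_bounded_linear bounded_linear_cadjoint suitable_integrable)

lemma semigroup_0:
  assumes "f \<in> \<A>"
  shows "T 0 f = f"
proof
  fix z
  interpret prob_space "\<P> z" by (rule prob_space_law)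
  have Z0: "Z 0 \<in> measurable (\<P> z) borel"
    using measurable_process[of 0] measurable_cong_sets[OF sets_law refl] by auto
  have "(\<integral>w. f (Z 0 w) \<partial>\<P> z) = (\<integral>w. f z \<partial>\<P> z)"
    using start[of z] assms
    by (intro integral_cong_AE measurable_compose[OF Z0] suitable_measurable const_closed) auto
  then show "T 0 f z = f z"
    by (simp add: markov_semigroup_def prob_space)
qed

lemma generator_eqI:
  "((\<lambda>t. (1 / t) *\<^sub>R (T t f z - f z)) \<longlongrightarrow> l) (at_right 0) \<Longrightarrow> L f z = l"
  unfolding generator_def by (intro tendsto_Lim trivial_limit_at_right_real)

lemma generator_add:
  assumes "f \<in> \<A>" "g \<in> \<A>"
  shows "L (\<lambda>x. f x + g x) z = L f z + L g z"
proof (rule generator_eqI)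
  have "eventually (\<lambda>t. (1 / t) *\<^sub>R (T t f z - f z) + (1 / t) *\<^sub>R (T t g z - g z)
      = (1 / t) *\<^sub>R (T t (\<lambda>x. f x + g x) z - (f z + g z))) (at_right 0)"
    using assms by (auto simp: eventually_at_filter semigroup_add algebra_simps intro!: always_eventually)
  then show "((\<lambda>t. (1 / t) *\<^sub>R (T t (\<lambda>x. f x + g x) z - (f z + g z))) \<longlongrightarrow> L f z + L g z) (at_right 0)"
    by (rule Lim_transform_eventually[rotated]) (intro tendsto_add generator_limit assms)
qed

lemma generator_scaleR:
  assumes "f \<in> \<A>"
  shows "L (\<lambda>x. r *\<^sub>R f x) z = r *\<^sub>R L f z"
proof (rule generator_eqI)
  have "((\<lambda>t. r *\<^sub>R ((1 / t) *\<^sub>R (T t f z - f z))) \<longlongrightarrow> r *\<^sub>R L f z) (at_right 0)"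
    by (intro tendsto_scaleR tendsto_const generator_limit assms)
  then show "((\<lambda>t. (1 / t) *\<^sub>R (T t (\<lambda>x. r *\<^sub>R f x) z - r *\<^sub>R f z)) \<longlongrightarrow> r *\<^sub>R L f z) (at_right 0)"
    by (simp add: semigroup_scaleR scaleR_diff_right mult.commute)
qed

lemma generator_diff:
  assumes "f \<in> \<A>" "g \<in> \<A>"
  shows "L (\<lambda>x. f x - g x) z = L f z - L g z"
  using generator_add[OF assms(1) scaleR_closed[OF assms(2), of "-1"]]
    generator_scaleR[OF assms(2), of "-1"] by simp

lemma generator_const: "L (\<lambda>x. A) z = 0"
  by (rule generator_eqI) (simp add: semigroup_const)

lemma generator_adjoint:
  assumes "f \<in> \<A>"
  shows "L (\<lambda>x. cadjoint (f x)) z = cadjoint (L f z)"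
proof (rule generator_eqI)
  have "eventually (\<lambda>t. cadjoint ((1 / t) *\<^sub>R (T t f z - f z))
      = (1 / t) *\<^sub>R (T t (\<lambda>x. cadjoint (f x)) z - cadjoint (f z))) (at_right 0)"
    using assms by (auto simp: eventually_at_filter semigroup_adjoint cadjoint_simps intro!: always_eventually)
  then show "((\<lambda>t. (1 / t) *\<^sub>R (T t (\<lambda>x. cadjoint (f x)) z - cadjoint (f z))) \<longlongrightarrow> cadjoint (L f z)) (at_right 0)"
    by (rule Lim_transform_eventually[rotated])
      (intro bounded_linear.tendsto[OF bounded_linear_cadjoint] generator_limit assms)
qed

text \<open>
  The adjoint reverses products, hence swaps the arguments of \<open>\<Gamma>\<close> and \<open>\<Gamma>\<^sub>2\<close>.  On the diagonal this says
  that both map Hermitian-valued functions to Hermitian-valued ones, as the order \<open>\<preceq>\<close> requires.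
\<close>
lemma carre_du_champ_adjoint:
  assumes "f \<in> \<A>" "g \<in> \<A>"
  shows "cadjoint (\<Gamma> f g z) = \<Gamma> (\<lambda>x. cadjoint (g x)) (\<lambda>x. cadjoint (f x)) z"
proof -
  have "cadjoint (L (\<lambda>x. f x ** g x) z) = L (\<lambda>x. cadjoint (g x) ** cadjoint (f x)) z"
    using generator_adjoint[of "\<lambda>x. f x ** g x" z] assms by (simp add: cadjoint_mult mult_closed)
  then show ?thesis
    using assms by (simp add: carre_du_champ_def cadjoint_simps cadjoint_mult generator_adjoint algebra_simps)
qed

lemma carre_du_champ2_adjoint:
  assumes "f \<in> \<A>" "g \<in> \<A>"
  shows "cadjoint (\<Gamma>\<^sub>2 f g z) = \<Gamma>\<^sub>2 (\<lambda>x. cadjoint (g x)) (\<lambda>x. cadjoint (f x)) z"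
proof -
  have L_adj: "L (\<lambda>x. cadjoint (h x)) = (\<lambda>x. cadjoint (L h x))" if "h \<in> \<A>" for h
    using generator_adjoint[OF that] by blast
  have "cadjoint (L (\<Gamma> f g) z) = L (\<Gamma> (\<lambda>x. cadjoint (g x)) (\<lambda>x. cadjoint (f x))) z"
    using generator_adjoint[OF carre_du_champ_closed[OF assms], of z]
    by (simp add: carre_du_champ_adjoint[OF assms])
  then show ?thesis
    using assms
    by (simp add: carre_du_champ2_def cadjoint_simps carre_du_champ_adjoint L_adj generator_closed algebra_simps)
qed

lemma hermitian_semigroup:
  "\<lbrakk>f \<in> suitable \<A>; 0 \<le> t\<rbrakk> \<Longrightarrow> hermitian (T t f z)"
  using semigroup_adjoint[of f t z] by (simp add: suitable_def hermitian_def)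

lemma semigroup_suitable: "\<lbrakk>f \<in> suitable \<A>; 0 \<le> t\<rbrakk> \<Longrightarrow> T t f \<in> suitable \<A>"
  using hermitian_semigroup[of f t] semigroup_closed[of f t] by (auto simp: suitable_def)

lemma carre_du_champ_suitable: "f \<in> suitable \<A> \<Longrightarrow> \<Gamma> f f \<in> suitable \<A>"
  using carre_du_champ_adjoint[of f f] carre_du_champ_closed[of f f]
  by (simp add: suitable_def hermitian_def)

lemma carre_du_champ2_suitable: "f \<in> suitable \<A> \<Longrightarrow> \<Gamma>\<^sub>2 f f \<in> suitable \<A>"
  using carre_du_champ2_adjoint[of f f] carre_du_champ2_closed[of f f]
  by (simp add: suitable_def hermitian_def)

text \<open>
  By stationarity \<open>\<mu>\<close> is the mixture of the laws of \<open>Z\<^sub>t\<close> over starting points distributed as \<open>\<mu>\<close>, so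
  for almost every starting point \<open>g(Z\<^sub>t)\<close> is almost surely positive semidefinite, and \<open>T\<^sub>t g\<close>
  is its mean.
\<close>
lemma AE_psd_semigroup:
  assumes stat: "stationary \<P> Z \<mu>" and g: "g \<in> \<A>" and psd: "AE z in \<mu>. psd (g z)" and t: "0 \<le> t"
  shows "AE z in \<mu>. psd (T t g z)"
proof -
  have sets: "sets \<mu> = sets borel" and inv: "\<mu> \<bind> transition_kernel \<P> Z t = \<mu>"
    using stat t by (auto simp: stationary_def)
  have kernel: "transition_kernel \<P> Z t \<in> measurable \<mu> (subprob_algebra borel)"
    using measurable_prob_algebraD[OF measurable_kernel[OF t]] measurable_cong_sets[OF sets refl] by auto
  have psd_meas: "Measurable.pred borel (\<lambda>z. psd (g z))"
    using measurable_sets[OF suitable_measurable[OF g] borel_closed[OF closed_psd]]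
    by (simp add: pred_def vimage_def)
  have "AE z in \<mu>. AE y in transition_kernel \<P> Z t z. psd (g y)"
    using psd unfolding AE_bind[OF kernel psd_meas, unfolded inv] .
  then show ?thesis
  proof eventually_elim
    fix z assume "AE y in transition_kernel \<P> Z t z. psd (g y)"
    moreover have Zt: "Z t \<in> measurable (\<P> z) borel"
      using measurable_process[OF t] measurable_cong_sets[OF sets_law refl] by auto
    moreover have "{y \<in> space borel. psd (g y)} \<in> sets borel"
      using psd_meas by (simp add: pred_def)
    ultimately have AE: "AE w in \<P> z. psd (g (Z t w))"
      unfolding transition_kernel_def by (subst (asm) AE_distr_iff)
    have int: "integrable (\<P> z) (\<lambda>w. g (Z t w))"
      using g t by (rule suitable_integrable)
    have "cadjoint (T t g z) = (\<integral>w. cadjoint (g (Z t w)) \<partial>\<P> z)"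
      unfolding markov_semigroup_def
      by (rule integral_bounded_linear[OF bounded_linear_cadjoint int, symmetric])
    also have "\<dots> = T t g z"
      unfolding markov_semigroup_def
    proof (rule integral_cong_AE)
      show "(\<lambda>w. cadjoint (g (Z t w))) \<in> borel_measurable (\<P> z)"
        using integrable_bounded_linear[OF bounded_linear_cadjoint int] by simp
      show "AE w in \<P> z. cadjoint (g (Z t w)) = g (Z t w)"
        using AE by eventually_elim (simp add: psd_iff_quad hermitian_def)
    qed (use int in simp)
    finally have "hermitian (T t g z)"
      by (simp add: hermitian_def)
    moreover have "0 \<le> quad v (T t g z)" for v
    proof -
      have "quad v (T t g z) = (\<integral>w. quad v (g (Z t w)) \<partial>\<P> z)"
        unfolding markov_semigroup_def
        by (rule integral_bounded_linear[OF bounded_linear_quad int, symmetric])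
      also have "\<dots> \<ge> 0"
        using AE by (intro integral_nonneg_AE) (auto simp: psd_iff_quad)
      finally show ?thesis .
    qed
    ultimately show "psd (T t g z)"
      by (simp add: psd_iff_quad)
  qed
qed

section \<open>Derivatives along the interpolation between inner and outer time\<close>

abbreviation evolved_product ::
    "('a \<Rightarrow> complex^'n^'n) \<Rightarrow> ('a \<Rightarrow> complex^'n^'n) \<Rightarrow> real \<Rightarrow> 'a \<Rightarrow> complex^'n^'n" where
  "evolved_product f g s \<equiv> \<lambda>x. T s f x ** T s g x"

abbreviation evolved_gamma ::
    "('a \<Rightarrow> complex^'n^'n) \<Rightarrow> ('a \<Rightarrow> complex^'n^'n) \<Rightarrow> real \<Rightarrow> 'a \<Rightarrow> complex^'n^'n" where
  "evolved_gamma f g s \<equiv> \<Gamma> (T s f) (T s g)"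

text \<open>
  Since \<open>L\<close> commutes with \<open>T\<^sub>s\<close>, the operators \<open>\<Gamma>\<close> and \<open>\<Gamma>\<^sub>2\<close> of evolved functions are combinations of
  products of evolved functions under at most two applications of \<open>L\<close>.  All regularity of the curves
  below is reduced to such products by the following expansions.
\<close>
lemma evolved_gamma_eq:
  assumes "f \<in> \<A>" "g \<in> \<A>" "0 \<le> s"
  shows "evolved_gamma f g s =
    (\<lambda>x. (1/2) *\<^sub>R (L (evolved_product f g s) x - evolved_product f (L g) s x - evolved_product (L f) g s x))"
  using assms by (simp add: carre_du_champ_def[abs_def] generator_commutes)

lemma evolved_gamma2_eq:
  assumes "f \<in> \<A>" "g \<in> \<A>" "0 \<le> s"
  shows "\<Gamma>\<^sub>2 (T s f) (T s g) =
    (\<lambda>x. (1/2) *\<^sub>R (L (evolved_gamma f g s) x - evolved_gamma f (L g) s x - evolved_gamma (L f) g s x))"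
  using assms by (simp add: carre_du_champ2_def[abs_def] generator_commutes)

lemma evolved_product_closed: "\<lbrakk>f \<in> \<A>; g \<in> \<A>; 0 \<le> s\<rbrakk> \<Longrightarrow> evolved_product f g s \<in> \<A>"
  by (intro mult_closed semigroup_closed)

lemma semigroup_evolved_gamma:
  assumes "f \<in> \<A>" "g \<in> \<A>" "0 \<le> s" "0 \<le> u"
  shows "T u (evolved_gamma f g s) z = (1/2) *\<^sub>R
    (T u (L (evolved_product f g s)) z - T u (evolved_product f (L g) s) z
      - T u (evolved_product (L f) g s) z)"
  unfolding evolved_gamma_eq[OF assms(1-3)]
  using assms by (simp add: semigroup_scaleR semigroup_diff closed_intros)

lemma generator_evolved_gamma:
  assumes "f \<in> \<A>" "g \<in> \<A>" "0 \<le> s"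
  shows "L (evolved_gamma f g s) z = (1/2) *\<^sub>R
    (L (L (evolved_product f g s)) z - L (evolved_product f (L g) s) z
      - L (evolved_product (L f) g s) z)"
  unfolding evolved_gamma_eq[OF assms]
  using assms by (simp add: generator_scaleR generator_diff closed_intros)

lemma semigroup_generator_evolved_gamma:
  assumes "f \<in> \<A>" "g \<in> \<A>" "0 \<le> s" "0 \<le> u"
  shows "T u (L (evolved_gamma f g s)) z = (1/2) *\<^sub>R
    (T u (L (L (evolved_product f g s))) z - T u (L (evolved_product f (L g) s)) z
      - T u (L (evolved_product (L f) g s)) z)"
proof -
  have "L (evolved_gamma f g s) = (\<lambda>z. (1/2) *\<^sub>R
    (L (L (evolved_product f g s)) z - L (evolved_product f (L g) s) z
      - L (evolved_product (L f) g s) z))"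
    using assms by (intro ext generator_evolved_gamma)
  then show ?thesis
    using assms by (simp add: semigroup_scaleR semigroup_diff closed_intros)
qed

lemma semigroup_evolved_gamma2:
  assumes "f \<in> \<A>" "g \<in> \<A>" "0 \<le> s" "0 \<le> u"
  shows "T u (\<Gamma>\<^sub>2 (T s f) (T s g)) z = (1/2) *\<^sub>R
    (T u (L (evolved_gamma f g s)) z - T u (evolved_gamma f (L g) s) z
      - T u (evolved_gamma (L f) g s) z)"
  unfolding evolved_gamma2_eq[OF assms(1-3)]
  using assms by (simp add: semigroup_scaleR semigroup_diff closed_intros)

lemma continuous_evolved_product:
  assumes "f \<in> \<A>" "g \<in> \<A>"
  shows "continuous_on ({0..} \<times> {0..}) (\<lambda>(u, s). T u (evolved_product f g s) z)"
    and "continuous_on ({0..} \<times> {0..}) (\<lambda>(u, s). T u (L (evolved_product f g s)) z)"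
    and "continuous_on ({0..} \<times> {0..}) (\<lambda>(u, s). T u (L (L (evolved_product f g s))) z)"
  using product_continuous[OF assms, of 0 z] product_continuous[OF assms, of 1 z]
    product_continuous[OF assms, of 2 z]
  by (simp_all add: numeral_2_eq_2)

lemma continuous_evolved_gamma:
  assumes "f \<in> \<A>" "g \<in> \<A>"
  shows "continuous_on ({0..} \<times> {0..}) (\<lambda>(u, s). T u (evolved_gamma f g s) z)"
    and "continuous_on ({0..} \<times> {0..}) (\<lambda>(u, s). T u (L (evolved_gamma f g s)) z)"
proof -
  have "continuous_on ({0..} \<times> {0..}) (\<lambda>(u, s). (1/2) *\<^sub>R
    (T u (L (evolved_product f g s)) z - T u (evolved_product f (L g) s) z
      - T u (evolved_product (L f) g s) z))"
    using assms unfolding case_prod_beta'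
    by (intro continuous_intros continuous_evolved_product[unfolded case_prod_beta'] generator_closed)
  then show "continuous_on ({0..} \<times> {0..}) (\<lambda>(u, s). T u (evolved_gamma f g s) z)"
    by (rule continuous_on_cong[THEN iffD1, rotated 2])
      (auto simp: semigroup_evolved_gamma assms)
  have "continuous_on ({0..} \<times> {0..}) (\<lambda>(u, s). (1/2) *\<^sub>R
    (T u (L (L (evolved_product f g s))) z - T u (L (evolved_product f (L g) s)) z
      - T u (L (evolved_product (L f) g s)) z))"
    using assms unfolding case_prod_beta'
    by (intro continuous_intros continuous_evolved_product[unfolded case_prod_beta'] generator_closed)
  then show "continuous_on ({0..} \<times> {0..}) (\<lambda>(u, s). T u (L (evolved_gamma f g s)) z)"
    by (rule continuous_on_cong[THEN iffD1, rotated 2])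
      (auto simp: semigroup_generator_evolved_gamma assms)
qed

lemma continuous_evolved_gamma2:
  assumes "f \<in> \<A>" "g \<in> \<A>"
  shows "continuous_on ({0..} \<times> {0..}) (\<lambda>(u, s). T u (\<Gamma>\<^sub>2 (T s f) (T s g)) z)"
proof -
  have "continuous_on ({0..} \<times> {0..}) (\<lambda>(u, s). (1/2) *\<^sub>R
    (T u (L (evolved_gamma f g s)) z - T u (evolved_gamma f (L g) s) z
      - T u (evolved_gamma (L f) g s) z))"
    using assms unfolding case_prod_beta'
    by (intro continuous_intros continuous_evolved_gamma[unfolded case_prod_beta'] generator_closed)
  then show ?thesis
    by (rule continuous_on_cong[THEN iffD1, rotated 2])
      (auto simp: semigroup_evolved_gamma2 assms)
qed

lemma continuous_on_antidiagonal:
  assumes "continuous_on ({0..} \<times> {0..}) (\<lambda>(u, s). F u s)"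
  shows "continuous_on {0..t} (\<lambda>s::real. F s (t - s))"
proof -
  have "continuous_on {0..t} (\<lambda>s. (\<lambda>(u, s). F u s) (s, t - s))"
    by (rule continuous_on_compose2[OF assms]) (auto intro!: continuous_intros)
  then show ?thesis by simp
qed

text \<open>
  The outer time runs forwards and contributes \<open>T\<^sub>s L\<close>; the inner time runs backwards and contributes
  the derivative \<open>k'\<close> of the inner curve with a minus sign.
\<close>
lemma semigroup_antidiagonal_derivative:
  assumes closed: "\<And>s. 0 \<le> s \<Longrightarrow> k s \<in> \<A>" "\<And>s. 0 \<le> s \<Longrightarrow> k' s \<in> \<A>"
    and deriv: "\<And>u s. \<lbrakk>0 \<le> u; 0 \<le> s\<rbrakk> \<Longrightarrow>
      ((\<lambda>r. T u (k r) z) has_vector_derivative T u (k' s) z) (at s within {0..})"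
    and cont: "continuous_on ({0..} \<times> {0..}) (\<lambda>(u, s). T u (k' s) z)"
    and s: "0 \<le> s" "s \<le> t"
  shows "((\<lambda>r. T r (k (t - r)) z) has_vector_derivative
      T s (\<lambda>x. L (k (t - s)) x - k' (t - s) x) z) (at s within {0..t})"
proof -
  have "((\<lambda>r. T r (k (t - r)) z) has_vector_derivative
      (T s (L (k (t - s))) z - T s (k' (t - s)) z)) (at s within {0..t})"
    by (rule has_vector_derivative_antidiagonal[where F = "\<lambda>u s. T u (k s) z"
          and ?F1.0 = "\<lambda>u s. T u (L (k s)) z" and ?F2.0 = "\<lambda>u s. T u (k' s) z"])
      (use closed deriv cont s semigroup_derivative in auto)
  then show ?thesis
    using closed s by (simp add: semigroup_diff closed_intros)
qed

text \<open>
  The inner curve is \<open>(T\<^sub>s f) (T\<^sub>s g)\<close>, and \<open>L\<close> of a product minus the product rule is \<open>2 \<Gamma>\<close>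
  by definition of \<open>\<Gamma>\<close>.
\<close>
lemma semigroup_product_derivative:
  assumes "f \<in> \<A>" "g \<in> \<A>" "0 \<le> s" "s \<le> t"
  shows "((\<lambda>r. T r (evolved_product f g (t - r)) z) has_vector_derivative
      2 *\<^sub>R T s (evolved_gamma f g (t - s)) z) (at s within {0..t})"
proof -
  let ?k' = "\<lambda>s x. evolved_product (L f) g s x + evolved_product f (L g) s x"
  have "((\<lambda>r. T r (evolved_product f g (t - r)) z) has_vector_derivative
      T s (\<lambda>x. L (evolved_product f g (t - s)) x - ?k' (t - s) x) z) (at s within {0..t})"
  proof (rule semigroup_antidiagonal_derivative)
    have "continuous_on ({0..} \<times> {0..})
        (\<lambda>(u, s). T u (evolved_product (L f) g s) z + T u (evolved_product f (L g) s) z)"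
      using assms unfolding case_prod_beta'
      by (intro continuous_intros continuous_evolved_product[unfolded case_prod_beta'] generator_closed)
    then show "continuous_on ({0..} \<times> {0..}) (\<lambda>(u, s). T u (?k' s) z)"
      by (rule continuous_on_cong[THEN iffD1, rotated 2])
        (use assms in \<open>auto simp: semigroup_add closed_intros\<close>)
  qed (use assms in \<open>auto intro!: closed_intros interchange_semigroup\<close>)
  moreover have "(\<lambda>x. L (evolved_product f g (t - s)) x - ?k' (t - s) x)
      = (\<lambda>x. 2 *\<^sub>R evolved_gamma f g (t - s) x)"
    using assms by (simp add: evolved_gamma_eq algebra_simps)
  ultimately show ?thesis
    by (simp add: semigroup_scaleR)
qed

text \<open>
  The same computation one level up: \<open>\<Gamma>\<close> is bilinear, so the inner curve \<open>\<Gamma> (T\<^sub>s f) (T\<^sub>s g)\<close> obeys a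
  product rule too, and \<open>L \<Gamma>\<close> minus that product rule is \<open>2 \<Gamma>\<^sub>2\<close>.
\<close>
lemma semigroup_gamma_derivative:
  assumes "f \<in> \<A>" "g \<in> \<A>" "0 \<le> s" "s \<le> t"
  shows "((\<lambda>r. T r (evolved_gamma f g (t - r)) z) has_vector_derivative
      2 *\<^sub>R T s (\<Gamma>\<^sub>2 (T (t - s) f) (T (t - s) g)) z) (at s within {0..t})"
proof -
  let ?k' = "\<lambda>s x. evolved_gamma (L f) g s x + evolved_gamma f (L g) s x"
  have "((\<lambda>r. T r (evolved_gamma f g (t - r)) z) has_vector_derivative
      T s (\<lambda>x. L (evolved_gamma f g (t - s)) x - ?k' (t - s) x) z) (at s within {0..t})"
  proof (rule semigroup_antidiagonal_derivative)
    fix u s :: real assume us: "0 \<le> u" "0 \<le> s"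
    have "((\<lambda>r. (1/2) *\<^sub>R
        (T u (L (evolved_product f g r)) z - T u (evolved_product f (L g) r) z
          - T u (evolved_product (L f) g r) z)) has_vector_derivative (1/2) *\<^sub>R
        (T u (L (\<lambda>x. evolved_product (L f) g s x + evolved_product f (L g) s x)) z
          - T u (\<lambda>x. evolved_product (L f) (L g) s x + evolved_product f (L (L g)) s x) z
          - T u (\<lambda>x. evolved_product (L (L f)) g s x + evolved_product (L f) (L g) s x) z))
        (at s within {0..})"
      using assms us
      by (intro bounded_linear.has_vector_derivative[OF bounded_linear_scaleR_right] has_vector_derivative_diff
          interchange_semigroup interchange_generator generator_closed)
    (* The six products regroup by which of f and g carries the additional L. *)
    also have "(1/2) *\<^sub>R
        (T u (L (\<lambda>x. evolved_product (L f) g s x + evolved_product f (L g) s x)) z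
          - T u (\<lambda>x. evolved_product (L f) (L g) s x + evolved_product f (L (L g)) s x) z
          - T u (\<lambda>x. evolved_product (L (L f)) g s x + evolved_product (L f) (L g) s x) z)
      = T u (?k' s) z"
    proof -
      have "L (\<lambda>x. evolved_product (L f) g s x + evolved_product f (L g) s x)
          = (\<lambda>x. L (evolved_product (L f) g s) x + L (evolved_product f (L g) s) x)"
        using assms us by (intro ext generator_add evolved_product_closed generator_closed)
      then show ?thesis
        using assms us
        by (simp add: semigroup_add semigroup_evolved_gamma closed_intros algebra_simps)
    qed
    finally show "((\<lambda>r. T u (evolved_gamma f g r) z) has_vector_derivative T u (?k' s) z)
        (at s within {0..})"
      by (rule has_vector_derivative_transform[rotated 2])
        (use assms us in \<open>auto simp: semigroup_evolved_gamma\<close>)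
  next
    have "continuous_on ({0..} \<times> {0..})
        (\<lambda>(u, s). T u (evolved_gamma (L f) g s) z + T u (evolved_gamma f (L g) s) z)"
      using assms unfolding case_prod_beta'
      by (intro continuous_intros continuous_evolved_gamma[unfolded case_prod_beta'] generator_closed)
    then show "continuous_on ({0..} \<times> {0..}) (\<lambda>(u, s). T u (?k' s) z)"
      by (rule continuous_on_cong[THEN iffD1, rotated 2])
        (use assms in \<open>auto simp: semigroup_add closed_intros\<close>)
  qed (use assms in \<open>auto intro!: closed_intros\<close>)
  moreover have "(\<lambda>x. L (evolved_gamma f g (t - s)) x - ?k' (t - s) x)
      = (\<lambda>x. 2 *\<^sub>R \<Gamma>\<^sub>2 (T (t - s) f) (T (t - s) g) x)"
    using assms by (simp add: evolved_gamma2_eq algebra_simps)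
  ultimately show ?thesis
    by (simp add: semigroup_scaleR)
qed

lemma carre_du_champ_one: "\<Gamma> f (\<lambda>x. mat 1) = (\<lambda>z. 0)"
proof
  fix z show "\<Gamma> f (\<lambda>x. mat 1) z = 0"
    by (simp add: carre_du_champ_def generator_const bounded_bilinear.zero_right[OF bounded_bilinear_matrix_mult])
qed

text \<open>
  With \<open>g = 1\<close> the product curve is \<open>T\<^sub>s (T\<^bsub>t-s\<^esub> f)\<close>, whose derivative is zero because \<open>\<Gamma> f 1 = 0\<close>; so
  the semigroup law follows from the differential calculus.
\<close>
lemma semigroup_law:
  assumes "f \<in> \<A>" "0 \<le> s" "s \<le> t"
  shows "T s (T (t - s) f) z = T t f z"
proof -
  have "((\<lambda>r. T r (T (t - r) f) z) has_derivative (\<lambda>h. 0)) (at r within {0..t})" if "r \<in> {0..t}" for r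
    using semigroup_product_derivative[OF assms(1) const_closed[of "mat 1"], of r t z] that
    by (simp add: semigroup_const carre_du_champ_one has_vector_derivative_def)
  from has_derivative_zero_unique[OF convex_real_interval(5) this, of s 0]
  have "T s (T (t - s) f) z = T 0 (T (t - 0) f) z"
    using assms by simp
  then show ?thesis
    using assms by (simp add: semigroup_0 semigroup_closed)
qed

section \<open>The cycle of implications\<close>

text \<open>
  Gronwall's argument for \<open>G(s) = T\<^sub>s \<Gamma>(T\<^bsub>t-s\<^esub> f)\<close>: its derivative is \<open>2 G2(s)\<close>, and the hypothesis for the
  suitable function \<open>T\<^bsub>t-s\<^esub> f\<close>, averaged by \<open>T\<^sub>s\<close>, gives \<open>G \<preceq> c G2\<close>.
\<close>
lemma bakry_emery_imp_local_ergodicity: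
  assumes stat: "stationary \<P> Z \<mu>" and c: "0 < c"
    and be: "\<And>f. f \<in> suitable \<A> \<Longrightarrow> AE z in \<mu>. \<Gamma> f f z \<preceq> c *\<^sub>R \<Gamma>\<^sub>2 f f z"
    and f: "f \<in> suitable \<A>" and t: "0 \<le> t"
  shows "AE z in \<mu>. \<Gamma> (T t f) (T t f) z \<preceq> exp (- 2 * t / c) *\<^sub>R T t (\<Gamma> f f) z"
proof -
  have fA: "f \<in> \<A>" using f by (simp add: suitable_def)
  define G G2 where "G = (\<lambda>s z. T s (evolved_gamma f f (t - s)) z)"
    and "G2 = (\<lambda>s z. T s (\<Gamma>\<^sub>2 (T (t - s) f) (T (t - s) f)) z)"
  have "AE z in \<mu>. \<forall>s\<in>{0..t}. c *\<^sub>R G2 s z - G s z \<in> {A. psd A}"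
  proof (rule AE_all_continuous[OF closed_psd])
    fix z show "continuous_on {0..t} (\<lambda>s. c *\<^sub>R G2 s z - G s z)"
      unfolding G_def G2_def
      using fA by (intro continuous_intros continuous_on_antidiagonal
          continuous_evolved_gamma continuous_evolved_gamma2)
  next
    fix s assume s: "s \<in> {0..t}"
    define g where "g = T (t - s) f"
    have g: "g \<in> suitable \<A>"
      using f s by (simp add: g_def semigroup_suitable)
    then have gA: "g \<in> \<A>"
      by (simp add: suitable_def)
    have "AE z in \<mu>. psd (c *\<^sub>R \<Gamma>\<^sub>2 g g z - \<Gamma> g g z)"
      using be[OF g] by (simp add: psd_le_def)
    then have "AE z in \<mu>. psd (T s (\<lambda>x. c *\<^sub>R \<Gamma>\<^sub>2 g g x - \<Gamma> g g x) z)"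
      using gA s by (intro AE_psd_semigroup[OF stat]) (auto intro!: closed_intros)
    then show "AE z in \<mu>. c *\<^sub>R G2 s z - G s z \<in> {A. psd A}"
      using gA s by (simp add: G_def G2_def g_def[symmetric] semigroup_diff semigroup_scaleR closed_intros)
  qed
  then show ?thesis
  proof eventually_elim
    fix z assume psd: "\<forall>s\<in>{0..t}. c *\<^sub>R G2 s z - G s z \<in> {A. psd A}"
    have ends: "G 0 z = \<Gamma> (T t f) (T t f) z" "G t z = T t (\<Gamma> f f) z"
      using fA t by (simp_all add: G_def semigroup_0 closed_intros)
    have "quad v (G 0 z) \<le> exp (- 2 * t / c) * quad v (G t z)" for v
    proof -
      have "exp (- 2 * 0 / c) * quad v (G 0 z) \<le> exp (- 2 * t / c) * quad v (G t z)"
      proof (rule nondecreasing_of_vector_derivative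
          [where \<phi>' = "\<lambda>s. (2 / c) * exp (- 2 * s / c) * quad v (c *\<^sub>R G2 s z - G s z)", OF t])
        fix s assume s: "0 \<le> s" "s \<le> t"
        have "((\<lambda>s. quad v (G s z)) has_vector_derivative quad v (2 *\<^sub>R G2 s z)) (at s within {0..t})"
          unfolding G_def G2_def
          by (rule bounded_linear.has_vector_derivative[OF bounded_linear_quad])
            (rule semigroup_gamma_derivative[OF fA fA s])
        then have "((\<lambda>s. quad v (G s z)) has_real_derivative 2 * quad v (G2 s z)) (at s within {0..t})"
          by (simp add: has_real_derivative_iff_has_vector_derivative quad_simps)
        then show "((\<lambda>s. exp (- 2 * s / c) * quad v (G s z)) has_vector_derivative
            (2 / c) * exp (- 2 * s / c) * quad v (c *\<^sub>R G2 s z - G s z)) (at s within {0..t})"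
          using c unfolding has_real_derivative_iff_has_vector_derivative[symmetric]
          by (auto intro!: derivative_eq_intros simp: quad_simps field_simps)
        show "0 \<le> (2 / c) * exp (- 2 * s / c) * quad v (c *\<^sub>R G2 s z - G s z)"
          using c psd s by (auto simp: psd_iff_quad)
      qed
      then show ?thesis by simp
    qed
    moreover have "hermitian (\<Gamma> (T t f) (T t f) z)"
      using carre_du_champ_suitable[OF semigroup_suitable[OF f t]] by (simp add: suitable_def)
    moreover have "hermitian (T t (\<Gamma> f f) z)"
      using carre_du_champ_suitable[OF f] t by (rule hermitian_semigroup)
    ultimately show "\<Gamma> (T t f) (T t f) z \<preceq> exp (- 2 * t / c) *\<^sub>R T t (\<Gamma> f f) z"
      unfolding ends by (intro psd_leI) (simp_all add: quad_simps hermitian_def cadjoint_simps)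
  qed
qed

text \<open>
  The curve \<open>Q(s) = T\<^sub>s((T\<^bsub>t-s\<^esub> f)\<^sup>2)\<close> runs from \<open>(T\<^sub>t f)\<^sup>2\<close> to \<open>T\<^sub>t(f\<^sup>2)\<close> with speed \<open>2 G(s)\<close>, where
  \<open>G(s) = T\<^sub>s \<Gamma>(T\<^bsub>t-s\<^esub> f)\<close>, and local ergodicity over the time \<open>t - s\<close> gives \<open>G(s) \<preceq> exp (-2 (t-s)/c) T\<^sub>t \<Gamma>(f)\<close>.
\<close>
lemma local_ergodicity_imp_local_poincare:
  assumes stat: "stationary \<P> Z \<mu>" and c: "0 < c"
    and le: "\<And>t f. \<lbrakk>0 \<le> t; f \<in> suitable \<A>\<rbrakk> \<Longrightarrow>
      AE z in \<mu>. \<Gamma> (T t f) (T t f) z \<preceq> exp (- 2 * t / c) *\<^sub>R T t (\<Gamma> f f) z"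
    and f: "f \<in> suitable \<A>" and t: "0 \<le> t"
  shows "AE z in \<mu>. T t (\<lambda>x. f x ** f x) z - T t f z ** T t f z
    \<preceq> (c * (1 - exp (- 2 * t / c))) *\<^sub>R T t (\<Gamma> f f) z"
proof -
  have fA: "f \<in> \<A>" using f by (simp add: suitable_def)
  define e where "e = (\<lambda>s. exp (- 2 * (t - s) / c))"
  define G where "G = (\<lambda>s z. T s (evolved_gamma f f (t - s)) z)"
  define Q where "Q = (\<lambda>s z. T s (evolved_product f f (t - s)) z)"
  have "AE z in \<mu>. \<forall>s\<in>{0..t}. e s *\<^sub>R T t (\<Gamma> f f) z - G s z \<in> {A. psd A}"
  proof (rule AE_all_continuous[OF closed_psd])
    fix z show "continuous_on {0..t} (\<lambda>s. e s *\<^sub>R T t (\<Gamma> f f) z - G s z)"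
      unfolding G_def e_def
      using fA c by (intro continuous_intros continuous_on_antidiagonal continuous_evolved_gamma) auto
  next
    fix s assume s: "s \<in> {0..t}"
    have "AE z in \<mu>. psd (e s *\<^sub>R T (t - s) (\<Gamma> f f) z - evolved_gamma f f (t - s) z)"
      using le[of "t - s" f] f s by (simp add: psd_le_def e_def)
    then have "AE z in \<mu>. psd (T s (\<lambda>x. e s *\<^sub>R T (t - s) (\<Gamma> f f) x - evolved_gamma f f (t - s) x) z)"
      using fA s by (intro AE_psd_semigroup[OF stat]) (auto intro!: closed_intros)
    then show "AE z in \<mu>. e s *\<^sub>R T t (\<Gamma> f f) z - G s z \<in> {A. psd A}"
      using fA s by (simp add: G_def semigroup_diff semigroup_scaleR semigroup_law closed_intros)
  qed
  then show ?thesis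
  proof eventually_elim
    fix z assume psd: "\<forall>s\<in>{0..t}. e s *\<^sub>R T t (\<Gamma> f f) z - G s z \<in> {A. psd A}"
    let ?K = "T t (\<Gamma> f f) z"
    have ends: "Q 0 z = T t f z ** T t f z" "Q t z = T t (\<lambda>x. f x ** f x) z"
      using fA t by (simp_all add: Q_def semigroup_0 closed_intros)
    have "quad v (Q t z - Q 0 z) \<le> quad v ((c * (1 - exp (- 2 * t / c))) *\<^sub>R ?K)" for v
    proof -
      (* c * e is an antiderivative of 2 * e, so the integral of the bound telescopes. *)
      have "c * e 0 * quad v ?K - quad v (Q 0 z) \<le> c * e t * quad v ?K - quad v (Q t z)"
      proof (rule nondecreasing_of_vector_derivative
          [where \<phi>' = "\<lambda>s. 2 * quad v (e s *\<^sub>R ?K - G s z)", OF t])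
        fix s assume s: "0 \<le> s" "s \<le> t"
        have "((\<lambda>s. quad v (Q s z)) has_vector_derivative quad v (2 *\<^sub>R G s z)) (at s within {0..t})"
          unfolding G_def Q_def
          by (rule bounded_linear.has_vector_derivative[OF bounded_linear_quad])
            (rule semigroup_product_derivative[OF fA fA s])
        then have "((\<lambda>s. quad v (Q s z)) has_real_derivative 2 * quad v (G s z)) (at s within {0..t})"
          by (simp add: has_real_derivative_iff_has_vector_derivative quad_simps)
        then show "((\<lambda>s. c * e s * quad v ?K - quad v (Q s z)) has_vector_derivative
            2 * quad v (e s *\<^sub>R ?K - G s z)) (at s within {0..t})"
          using c unfolding has_real_derivative_iff_has_vector_derivative[symmetric] e_def
          by (auto intro!: derivative_eq_intros simp: quad_simps field_simps)
        show "0 \<le> 2 * quad v (e s *\<^sub>R ?K - G s z)"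
          using psd s by (auto simp: psd_iff_quad)
      qed
      then show ?thesis by (simp add: e_def quad_simps algebra_simps)
    qed
    moreover have "hermitian (Q s z)" if "s \<in> {0..t}" for s
    proof -
      have "evolved_product f f (t - s) \<in> suitable \<A>"
        using hermitian_semigroup[OF f, of "t - s"] that fA
        by (auto simp: suitable_def hermitian_def cadjoint_mult closed_intros)
      then show ?thesis
        unfolding Q_def using that by (intro hermitian_semigroup) auto
    qed
    from this[of 0] this[of t] t have "hermitian (Q t z - Q 0 z)"
      by (simp add: hermitian_def cadjoint_simps)
    moreover have "hermitian ?K"
      using carre_du_champ_suitable[OF f] t by (rule hermitian_semigroup)
    ultimately show "T t (\<lambda>x. f x ** f x) z - T t f z ** T t f z
        \<preceq> (c * (1 - exp (- 2 * t / c))) *\<^sub>R ?K"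
      unfolding ends by (intro psd_leI) (simp_all add: hermitian_def cadjoint_simps)
  qed
qed

text \<open>
  Second-order expansion at \<open>t = 0\<close> of \<open>Y\<close>, the right-hand side of the Poincare inequality minus its
  left-hand side.  The constant \<open>c (1 - exp (-2 t/c))\<close> has slope exactly 2 at 0, which matches
  \<open>L(f\<^sup>2) - f L f - (L f) f = 2 \<Gamma>(f)\<close> and makes the first-order terms cancel.
\<close>
lemma local_poincare_imp_bakry_emery:
  assumes c: "0 < c"
    and lp: "\<And>t. 0 \<le> t \<Longrightarrow> AE z in \<mu>. T t (\<lambda>x. f x ** f x) z - T t f z ** T t f z
      \<preceq> (c * (1 - exp (- 2 * t / c))) *\<^sub>R T t (\<Gamma> f f) z"
    and f: "f \<in> suitable \<A>"
  shows "AE z in \<mu>. \<Gamma> f f z \<preceq> c *\<^sub>R \<Gamma>\<^sub>2 f f z"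
proof -
  have fA: "f \<in> \<A>" using f by (simp add: suitable_def)
  let ?f2 = "\<lambda>x. f x ** f x"
  define Y where "Y = (\<lambda>t z. (c * (1 - exp (- 2 * t / c))) *\<^sub>R T t (\<Gamma> f f) z
    - (T t ?f2 z - T t f z ** T t f z))"
  define Y' where "Y' = (\<lambda>t z. (2 * exp (- 2 * t / c)) *\<^sub>R T t (\<Gamma> f f) z
    + (c * (1 - exp (- 2 * t / c))) *\<^sub>R T t (L (\<Gamma> f f)) z
    - (T t (L ?f2) z - (T t f z ** T t (L f) z + T t (L f) z ** T t f z)))"
  note mult_deriv = bounded_bilinear.has_vector_derivative[OF bounded_bilinear_matrix_mult]
  note scale_deriv = bounded_bilinear.has_vector_derivative[OF bounded_bilinear_scaleR]
  have coeff: "((\<lambda>t. c * (1 - exp (- 2 * t / c))) has_vector_derivative 2 * exp (- 2 * s / c)) (at s within {0..})"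
    "((\<lambda>t. 2 * exp (- 2 * t / c)) has_vector_derivative - (4 / c) * exp (- 2 * s / c)) (at s within {0..})" for s
    using c unfolding has_real_derivative_iff_has_vector_derivative[symmetric]
    by (auto intro!: derivative_eq_intros simp: field_simps)
  have dY: "((\<lambda>t. Y t z) has_vector_derivative Y' s z) (at s within {0..})" if s: "0 \<le> s" for s z
  proof -
    have "((\<lambda>t. Y t z) has_vector_derivative
      ((c * (1 - exp (- 2 * s / c))) *\<^sub>R T s (L (\<Gamma> f f)) z + (2 * exp (- 2 * s / c)) *\<^sub>R T s (\<Gamma> f f) z
        - (T s (L ?f2) z - (T s f z ** T s (L f) z + T s (L f) z ** T s f z)))) (at s within {0..})"
      unfolding Y_def using fA s
      by (intro has_vector_derivative_diff scale_deriv mult_deriv coeff semigroup_derivative closed_intros)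
    then show ?thesis by (simp add: Y'_def algebra_simps)
  qed
  have dY': "((\<lambda>t. Y' t z) has_vector_derivative 4 *\<^sub>R \<Gamma>\<^sub>2 f f z - (4 / c) *\<^sub>R \<Gamma> f f z) (at 0 within {0..})" for z
  proof -
    let ?D = "((2 * exp (- 2 * 0 / c)) *\<^sub>R T 0 (L (\<Gamma> f f)) z + (- (4 / c) * exp (- 2 * 0 / c)) *\<^sub>R T 0 (\<Gamma> f f) z
        + ((c * (1 - exp (- 2 * 0 / c))) *\<^sub>R T 0 (L (L (\<Gamma> f f))) z + (2 * exp (- 2 * 0 / c)) *\<^sub>R T 0 (L (\<Gamma> f f)) z)
        - (T 0 (L (L ?f2)) z
          - ((T 0 f z ** T 0 (L (L f)) z + T 0 (L f) z ** T 0 (L f) z)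
            + (T 0 (L f) z ** T 0 (L f) z + T 0 (L (L f)) z ** T 0 f z))))"
    have "((\<lambda>t. Y' t z) has_vector_derivative ?D) (at 0 within {0..})"
      unfolding Y'_def using fA
      by (intro has_vector_derivative_diff has_vector_derivative_add scale_deriv mult_deriv coeff
          semigroup_derivative closed_intros order_refl)
    also have "?D = 4 *\<^sub>R \<Gamma>\<^sub>2 f f z - (4 / c) *\<^sub>R \<Gamma> f f z"
    proof -
      (* Expanding L (f f) through \<Gamma> makes \<Gamma>(f, L f) and \<Gamma>(L f, f), hence \<Gamma>\<^sub>2, appear. *)
      have "L ?f2 = (\<lambda>x. 2 *\<^sub>R \<Gamma> f f x + (f x ** L f x + L f x ** f x))"
        by (simp add: carre_du_champ_def)
      then have "L (L ?f2) z = 2 *\<^sub>R L (\<Gamma> f f) z + (L (\<lambda>x. f x ** L f x) z + L (\<lambda>x. L f x ** f x) z)"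
        using fA by (simp add: generator_add generator_scaleR closed_intros)
      then show ?thesis
        using fA by (simp add: semigroup_0 closed_intros carre_du_champ2_def carre_du_champ_def scaleR_2 algebra_simps)
    qed
    finally show ?thesis .
  qed
  have "AE z in \<mu>. \<forall>t\<in>{0..}. Y t z \<in> {A. psd A}"
  proof (rule AE_all_continuous[OF closed_psd])
    fix z show "continuous_on {0..} (\<lambda>t. Y t z)"
      using dY by (auto simp: continuous_on_eq_continuous_within intro: has_vector_derivative_continuous)
  qed (use lp in \<open>simp add: Y_def psd_le_def\<close>)
  then show ?thesis
  proof eventually_elim
    fix z assume psd: "\<forall>t\<in>{0..}. Y t z \<in> {A. psd A}"
    have "quad v (\<Gamma> f f z) \<le> quad v (c *\<^sub>R \<Gamma>\<^sub>2 f f z)" for v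
    proof -
      have "0 \<le> quad v (4 *\<^sub>R \<Gamma>\<^sub>2 f f z - (4 / c) *\<^sub>R \<Gamma> f f z)"
      proof (rule second_derivative_nonneg[where \<phi> = "\<lambda>t. quad v (Y t z)" and \<phi>' = "\<lambda>t. quad v (Y' t z)"])
        show "((\<lambda>t. quad v (Y t z)) has_vector_derivative quad v (Y' s z)) (at s within {0..})"
          if "0 \<le> s" for s
          by (rule bounded_linear.has_vector_derivative[OF bounded_linear_quad dY[OF that]])
        show "((\<lambda>t. quad v (Y' t z)) has_vector_derivative
            quad v (4 *\<^sub>R \<Gamma>\<^sub>2 f f z - (4 / c) *\<^sub>R \<Gamma> f f z)) (at 0 within {0..})"
          by (rule bounded_linear.has_vector_derivative[OF bounded_linear_quad dY'])
        show "quad v (Y 0 z) = 0"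
          using fA by (simp add: Y_def semigroup_0 closed_intros quad_simps)
        have "Y' 0 z = 0"
          using fA by (simp add: Y'_def semigroup_0 closed_intros carre_du_champ_def)
        then show "quad v (Y' 0 z) = 0"
          by (simp add: quad_def)
      qed (use psd in \<open>simp add: psd_iff_quad\<close>)
      then have "0 \<le> (c / 4) * quad v (4 *\<^sub>R \<Gamma>\<^sub>2 f f z - (4 / c) *\<^sub>R \<Gamma> f f z)"
        using c by simp
      then show ?thesis
        using c by (simp add: quad_simps field_simps)
    qed
    then show "\<Gamma> f f z \<preceq> c *\<^sub>R \<Gamma>\<^sub>2 f f z"
      using carre_du_champ_suitable[OF f] carre_du_champ2_suitable[OF f]
      by (intro psd_leI) (simp_all add: suitable_def hermitian_def cadjoint_simps)
  qed
qed

end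

theorem proposition2p8:
  fixes W :: "'w measure"
    and \<P> :: "'a::polish_space \<Rightarrow> 'w measure"
    and Z :: "real \<Rightarrow> 'w \<Rightarrow> 'a"
    and \<mu> :: "'a measure"
    and \<A> :: "('a \<Rightarrow> complex^'n^'n) set"
    and P :: "real \<Rightarrow> ('a \<Rightarrow> complex^'n^'n) \<Rightarrow> 'a \<Rightarrow> complex^'n^'n"
    and \<Gamma> \<Gamma>\<^sub>2 :: "('a \<Rightarrow> complex^'n^'n) \<Rightarrow> 'a \<Rightarrow> complex^'n^'n"
    and c :: real
  assumes "suitable_algebra W \<P> Z \<A>"
    and "stationary \<P> Z \<mu>"
    and P: "P = markov_semigroup \<P> Z"
    and \<Gamma>: "\<Gamma> = (\<lambda>f. carre_du_champ P f f)"
    and \<Gamma>\<^sub>2: "\<Gamma>\<^sub>2 = (\<lambda>f. carre_du_champ2 P f f)"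
    and "c > 0"
  defines "bakry_emery \<equiv> \<forall>f\<in>suitable \<A>. AE z in \<mu>. \<Gamma> f z \<preceq> c *\<^sub>R \<Gamma>\<^sub>2 f z"
    and "local_ergodicity \<equiv>
      \<forall>t\<ge>0. \<forall>f\<in>suitable \<A>. AE z in \<mu>. \<Gamma> (P t f) z \<preceq> exp (- 2 * t / c) *\<^sub>R P t (\<Gamma> f) z"
    and "local_poincare \<equiv>
      \<forall>t\<ge>0. \<forall>f\<in>suitable \<A>. AE z in \<mu>.
        P t (\<lambda>x. f x ** f x) z - P t f z ** P t f z
          \<preceq> (c * (1 - exp (- 2 * t / c))) *\<^sub>R P t (\<Gamma> f) z"
  shows "(bakry_emery \<longleftrightarrow> local_ergodicity) \<and> (local_ergodicity \<longleftrightarrow> local_poincare)"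
proof -
  interpret suitable_algebra W \<P> Z \<A> by fact
  note [simp] = bakry_emery_def local_ergodicity_def local_poincare_def P \<Gamma> \<Gamma>\<^sub>2
  have "local_ergodicity" if "bakry_emery"
    using bakry_emery_imp_local_ergodicity[OF \<open>stationary \<P> Z \<mu>\<close> \<open>c > 0\<close>] that by simp
  moreover have "local_poincare" if "local_ergodicity"
    using local_ergodicity_imp_local_poincare[OF \<open>stationary \<P> Z \<mu>\<close> \<open>c > 0\<close>] that by simp
  moreover have "bakry_emery" if "local_poincare"
    using local_poincare_imp_bakry_emery[OF \<open>c > 0\<close>] that by simp
  ultimately show ?thesis by blast
qed

end
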